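(* Let $N\ge 2$, let $\Omega\subset\mathbb{R}^N$ be a smooth bounded domain, let $0<a\le 2$, and let $K$, $f$, $g$ satisfy the standing assumptions given in the context. Assume that $K>0$ in $\overline\Omega$ and $\int_0^1 g(s)\,ds=+\infty$. Then, for every $\lambda>0$, the problem $$-\Delta u+K(x)g(u)+|\nabla u|^a=\lambda f(x,u)\ \text{ in }\Omega,\qquad u>0\ \text{ in }\Omega,\qquad u=0\ \text{ on }\partial\Omega$$ has no classical solutions.
   Context: A classical solution is a function $u\in C^2(\Omega)\cap C(\overline\Omega)$ satisfying the equation pointwise in $\Omega$, with $u>0$ in $\Omega$ and $u=0$ on $\partial\Omega$. Standing assumptions: - $K\in C^{0,\gamma}(\overline\Omega)$ for some $0<\gamma<1$. - $f:\overline\Omega\times[0,\infty)\to[0,\infty)$ is a Hölder continuous function which is positive on $\overline\Omega\times(0,\infty)$ and nondecreasing with respect to the second variable. For every $x\in\overline\Omega$ the mapping $(0,\infty)\ni s\mapsto f(x,s)/s$ is nonincreasing. Moreover $\lim_{s\to0^+}f(x,s)/s=+\infty$ and $\lim_{s\to\infty}f(x,s)/s=0$, both uniformly for $x\in\overline\Omega$. - $g\in C^{0,\gamma}(0,\infty)$ (understood locally, i.e. Hölder continuous with exponent $\gamma$ on compact subintervals of $(0,\infty)$) is a nonnegative and nonincreasing function with $\lim_{s\to0^+}g(s)=+\infty$. *)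

theory Defs
  imports "HOL-Analysis.Analysis"
begin

definition partial :: "'n \<Rightarrow> (real ^ 'n \<Rightarrow> real) \<Rightarrow> real ^ 'n \<Rightarrow> real" where
  "partial i u x = frechet_derivative u (at x) (axis i 1)"

definition grad :: "(real ^ 'n \<Rightarrow> real) \<Rightarrow> real ^ 'n \<Rightarrow> real ^ 'n" where
  "grad u x = (\<chi> i. partial i u x)"

definition laplacian :: "(real ^ 'n \<Rightarrow> real) \<Rightarrow> real ^ 'n \<Rightarrow> real" where
  "laplacian u x = (\<Sum>i\<in>UNIV. partial i (partial i u) x)"

text \<open>The class \<open>C\<^sup>k(S)\<close>, meant for open \<open>S\<close>: differentiability is taken at the points of \<open>S\<close>
  with respect to the whole space, so the values outside \<open>S\<close> are irrelevant.\<close>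

primrec Ck_on :: "nat \<Rightarrow> (real ^ 'n \<Rightarrow> real) \<Rightarrow> (real ^ 'n) set \<Rightarrow> bool" where
  "Ck_on 0 u S \<longleftrightarrow> continuous_on S u"
| "Ck_on (Suc k) u S \<longleftrightarrow> (\<forall>x\<in>S. u differentiable (at x)) \<and> (\<forall>i. Ck_on k (partial i u) S)"

definition holder_on :: "real \<Rightarrow> 'a::metric_space set \<Rightarrow> ('a \<Rightarrow> 'b::metric_space) \<Rightarrow> bool" where
  "holder_on \<alpha> S h \<longleftrightarrow> (\<exists>C. \<forall>x\<in>S. \<forall>y\<in>S. dist (h x) (h y) \<le> C * dist x y powr \<alpha>)"

text \<open>Near each boundary point, after relabelling the axes and possibly reversing one of them
  (\<open>\<sigma>\<close>), \<open>\<Omega>\<close> is the part of a ball lying above the graph of a \<open>C\<^sup>\<infinity>\<close> function of the other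
  \<open>N - 1\<close> coordinates.  Such a function is represented by a function \<open>\<phi>\<close> on the whole space that
  does not depend on the coordinate \<open>k\<close>.\<close>

definition smooth_boundary :: "(real ^ 'n) set \<Rightarrow> bool" where
  "smooth_boundary \<Omega> \<longleftrightarrow>
     (\<forall>p\<in>frontier \<Omega>. \<exists>r>0. \<exists>k. \<exists>\<sigma>\<in>{-1, 1}. \<exists>\<phi>.
        (\<forall>m. Ck_on m \<phi> UNIV) \<and>
        (\<forall>x y. (\<forall>i. i \<noteq> k \<longrightarrow> x $ i = y $ i) \<longrightarrow> \<phi> x = \<phi> y) \<and>
        \<Omega> \<inter> ball p r = {x \<in> ball p r. \<phi> x < \<sigma> * x $ k})"

definition smooth_bounded_domain :: "(real ^ 'n) set \<Rightarrow> bool" where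
  "smooth_bounded_domain \<Omega> \<longleftrightarrow>
     open \<Omega> \<and> connected \<Omega> \<and> \<Omega> \<noteq> {} \<and> bounded \<Omega> \<and> smooth_boundary \<Omega>"

definition classical_solution ::
  "(real ^ 'n) set \<Rightarrow> (real ^ 'n \<Rightarrow> real) \<Rightarrow> (real ^ 'n \<Rightarrow> real \<Rightarrow> real) \<Rightarrow> (real \<Rightarrow> real) \<Rightarrow>
    real \<Rightarrow> real \<Rightarrow> (real ^ 'n \<Rightarrow> real) \<Rightarrow> bool" where
  "classical_solution \<Omega> K f g a lam u \<longleftrightarrow>
     Ck_on 2 u \<Omega> \<and> continuous_on (closure \<Omega>) u \<and>
     (\<forall>x\<in>\<Omega>. - laplacian u x + K x * g (u x) + norm (grad u x) powr a = lam * f x (u x)) \<and>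
     (\<forall>x\<in>\<Omega>. 0 < u x) \<and> (\<forall>x\<in>frontier \<Omega>. u x = 0)"

end

theory Submission
  imports Defs
begin

text \<open>
  The gradient term has the favourable sign and \<open>K\<close> is bounded below by some \<open>k > 0\<close>, while
  \<open>\<lambda> f(x,u)\<close> is bounded because \<open>u\<close> is.  A classical solution therefore satisfies
  \<open>\<Delta> u \<ge> k g(u) - C\<close> in \<open>\<Omega>\<close>.  No function that is positive in
  \<open>\<Omega>\<close> and vanishes on the boundary can do so: it would be so convex in the direction normal to the
  boundary that it would have to become negative near it.  Only the maximum principle
  and two barriers near a single boundary point \<open>p\<close> are used; nothing is integrated over \<open>\<Omega>\<close>.

  Near \<open>p\<close> let \<open>t = \<sigma> x\<^sub>k - \<phi>(x)\<close> be the height above the boundary graph.  It is smooth,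
  vanishes on the boundary, is positive in \<open>\<Omega>\<close>, and \<open>|\<nabla> t| \<ge> 1\<close>.  Both barriers have
  the form \<open>\<psi>(t(x)) + M |x - x\<^sub>0|\<^sup>2\<close>: the quadratic term dominates \<open>u\<close> on a small sphere around
  \<open>x\<^sub>0\<close> and vanishes at \<open>x\<^sub>0\<close> itself, so comparison gives \<open>u(x\<^sub>0) \<le> \<psi>(t(x\<^sub>0))\<close>
  (lemma \<open>barrier\<close>).

  The inequality \<open>\<Delta> u \<ge> -C\<close> and a concave quadratic \<open>\<psi>\<close> give \<open>u \<le> A t\<close> near \<open>p\<close>
  (lemma \<open>linear_upper_bound\<close>).  After replacing \<open>t\<close> by \<open>A t\<close> one has \<open>u \<le> t\<close>, and
  since \<open>g\<close> is nonincreasing, \<open>\<Delta> u \<ge> k g(t) - C\<close>: the singular term is now a function of \<open>t\<close>.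
  This matters because \<open>g\<close> is nonincreasing, so that \<open>-\<Delta> u + k g(u)\<close> obeys no comparison principle,
  whereas \<open>-\<Delta> u\<close> does.
  Because \<open>g\<close> has infinite integral at \<open>0\<close>, there is a convex \<open>\<psi>\<close> with \<open>\<psi>'' \<le> b g\<close>, with
  \<open>\<psi>(0) = 0\<close> and \<open>\<psi>'(0) = -1\<close>, and with bounds on \<open>\<psi>\<close> and \<open>\<psi>'\<close> that do not depend on the
  interval on which it is built (lemma \<open>convex_profile\<close>).  With this \<open>\<psi>\<close> the barrier gives
  \<open>u(x\<^sub>0) \<le> \<psi>(t(x\<^sub>0)) < 0\<close> for \<open>x\<^sub>0\<close> close to \<open>p\<close>, contradicting \<open>u > 0\<close>.
\<close>

section \<open>Partial derivatives along coordinate lines\<close>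

text \<open>As a one-variable derivative along a line, the partial derivative of a barrier can be computed
  with the one-variable rules, and no Frechet derivative of the barrier is needed.\<close>

definition has_partial :: "'n \<Rightarrow> (real ^ 'n \<Rightarrow> real) \<Rightarrow> real \<Rightarrow> real ^ 'n \<Rightarrow> bool" where
  "has_partial i v d x \<longleftrightarrow> ((\<lambda>s. v (x + s *\<^sub>R axis i 1)) has_real_derivative d) (at 0)"

lemma has_partial_partial:
  fixes v :: "real ^ 'n \<Rightarrow> real"
  assumes "v differentiable (at x)"
  shows "has_partial i v (partial i v x) x"
proof -
  have v: "(v has_derivative frechet_derivative v (at x)) (at (x + 0 *\<^sub>R axis i 1))"
    using assms by (simp add: frechet_derivative_works)
  have l: "((\<lambda>s::real. x + s *\<^sub>R axis i 1) has_derivative (\<lambda>s. s *\<^sub>R axis i 1)) (at 0)"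
    by (auto intro!: derivative_eq_intros)
  have "linear (frechet_derivative v (at x))"
    using assms frechet_derivative_works has_derivative_linear by blast
  then have "frechet_derivative v (at x) (s *\<^sub>R axis i 1) = partial i v x * s" for s
    by (simp add: partial_def linear_scale)
  then show ?thesis
    using has_derivative_compose[OF l v]
    by (simp add: has_partial_def has_field_derivative_def)
qed

lemma has_partial_shift:
  assumes "has_partial i v d (x + s *\<^sub>R axis i 1)"
  shows "((\<lambda>s. v (x + s *\<^sub>R axis i 1)) has_real_derivative d) (at s)"
  using assms DERIV_shift[of "\<lambda>s. v (x + s *\<^sub>R axis i 1)" d 0 s]
  by (simp add: has_partial_def algebra_simps)

lemma has_partial_const: "has_partial i (\<lambda>x. c) 0 x"
  by (simp add: has_partial_def)

lemma has_partial_diff: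
  "has_partial i v d x \<Longrightarrow> has_partial i w e x \<Longrightarrow> has_partial i (\<lambda>x. v x - w x) (d - e) x"
  unfolding has_partial_def by (rule DERIV_diff)

lemma has_partial_add:
  "has_partial i v d x \<Longrightarrow> has_partial i w e x \<Longrightarrow> has_partial i (\<lambda>x. v x + w x) (d + e) x"
  unfolding has_partial_def by (rule DERIV_add)

lemma has_partial_cmult:
  "has_partial i v d x \<Longrightarrow> has_partial i (\<lambda>x. c * v x) (c * d) x"
  unfolding has_partial_def by (rule DERIV_cmult)

lemma has_partial_mult:
  "has_partial i v d x \<Longrightarrow> has_partial i w e x \<Longrightarrow>
    has_partial i (\<lambda>x. v x * w x) (d * w x + e * v x) x"
  unfolding has_partial_def by (drule (1) DERIV_mult) simp

lemma has_partial_compose: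
  assumes "(\<psi> has_real_derivative e) (at (v x))" "has_partial i v d x"
  shows "has_partial i (\<lambda>x. \<psi> (v x)) (e * d) x"
  unfolding has_partial_def
  by (rule DERIV_chain2[where f = \<psi>]) (use assms in \<open>simp_all add: has_partial_def\<close>)

lemma has_partial_nth: "has_partial i (\<lambda>x. x $ k - c) (if i = k then 1 else 0) x"
  unfolding has_partial_def by (auto simp: axis_def intro!: derivative_eq_intros)

lemma has_partial_nth_same: "has_partial i (\<lambda>x. x $ i - c) 1 x"
  using has_partial_nth[of i i c x] by simp

lemma has_partial_norm_sq:
  fixes x y :: "real ^ 'n"
  shows "has_partial i (\<lambda>x. (norm (x - y))\<^sup>2) (2 * (x $ i - y $ i)) x"
proof -
  have *: "(norm (x + s *\<^sub>R axis i 1 - y))\<^sup>2 = (norm (x - y))\<^sup>2 + 2 * s * (x $ i - y $ i) + s\<^sup>2"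
    for s :: real
  proof -
    define z where "z = x - y"
    have "(norm (x + s *\<^sub>R axis i 1 - y))\<^sup>2 = (z + s *\<^sub>R axis i 1) \<bullet> (z + s *\<^sub>R axis i 1)"
      by (simp add: z_def power2_norm_eq_inner algebra_simps)
    also have "\<dots> = z \<bullet> z + 2 * s * (z \<bullet> axis i 1) + s\<^sup>2 * (axis i 1 \<bullet> (axis i 1 :: real ^ 'n))"
      by (simp add: inner_add_left inner_add_right inner_commute power2_eq_square algebra_simps)
    finally show ?thesis by (simp add: z_def power2_norm_eq_inner inner_axis inner_axis')
  qed
  show ?thesis
    unfolding has_partial_def * by (auto intro!: derivative_eq_intros)
qed

section \<open>The maximum principle\<close>

text \<open>The first partial derivative vanishes at \<open>x\<close>.  Were the second one positive, the first would be
  positive just beyond \<open>x\<close> on the coordinate line, and \<open>v\<close> would increase there.\<close>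

lemma second_partial_le_0_at_max:
  fixes v :: "real ^ 'n \<Rightarrow> real"
  assumes D: "open D" "x \<in> D"
    and v1: "\<And>y. y \<in> D \<Longrightarrow> has_partial i v (v1 y) y"
    and v2: "has_partial i v1 d x"
    and max: "\<And>y. y \<in> D \<Longrightarrow> v y \<le> v x"
  shows "d \<le> 0"
proof (rule ccontr)
  assume "\<not> d \<le> 0"
  define l where "l = (\<lambda>s::real. x + s *\<^sub>R axis i 1)"
  have "open (l -` D)"
    unfolding l_def by (intro open_vimage D continuous_intros)
  moreover have "0 \<in> l -` D" using D by (simp add: l_def)
  ultimately obtain e where e: "e > 0" "\<And>s. \<bar>s\<bar> < e \<Longrightarrow> l s \<in> D"
    by (force simp: open_dist dist_real_def)
  have d1: "((\<lambda>s. v (l s)) has_real_derivative v1 (l s)) (at s)" if "\<bar>s\<bar> < e" for s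
    using v1[OF e(2)[OF that]] unfolding l_def by (rule has_partial_shift)
  have "v1 (l 0) = 0"
  proof (rule DERIV_local_max[OF d1 e(1)])
    show "\<forall>y. \<bar>0 - y\<bar> < e \<longrightarrow> v (l y) \<le> v (l 0)"
      using e(2) max by (simp add: l_def)
  qed (use e in simp)
  moreover have "((\<lambda>s. v1 (l s)) has_real_derivative d) (at 0)"
    using v2 by (simp add: has_partial_def l_def)
  then obtain \<delta> where \<delta>: "\<delta> > 0" "\<And>h. 0 < h \<Longrightarrow> h < \<delta> \<Longrightarrow> v1 (l 0) < v1 (l h)"
    using \<open>\<not> d \<le> 0\<close> DERIV_pos_inc_right[of "\<lambda>s. v1 (l s)" d 0] by auto
  ultimately have pos: "v1 (l h) > 0" if "0 < h" "h < \<delta>" for h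
    using that by fastforce
  define b where "b = min e \<delta> / 2"
  have b: "0 < b" "b < e" "b < \<delta>" using e \<delta> by (auto simp: b_def)
  have "v (l 0) < v (l b)"
  proof (rule DERIV_pos_imp_increasing_open[OF b(1)])
    fix s assume "0 < s" "s < b"
    then show "\<exists>y. ((\<lambda>s. v (l s)) has_real_derivative y) (at s) \<and> 0 < y"
      using d1[of s] pos[of s] b by auto
  next
    show "continuous_on {0..b} (\<lambda>s. v (l s))"
      using b by (intro continuous_at_imp_continuous_on ballI DERIV_isCont[OF d1]) auto
  qed
  with max[OF e(2)[of b]] b show False by (simp add: l_def)
qed

text \<open>Since the sum of the pure second partial derivatives is strictly positive, a positive maximum
  cannot be interior: there each of them would be at most \<open>0\<close>.\<close>

lemma weak_maximum_principle:
  fixes v :: "real ^ 'n \<Rightarrow> real"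
  assumes D: "open D" "bounded D"
    and cont: "continuous_on (closure D) v"
    and frontier: "\<And>x. x \<in> frontier D \<Longrightarrow> v x \<le> 0"
    and v1: "\<And>i x. x \<in> D \<Longrightarrow> has_partial i v (v1 i x) x"
    and v2: "\<And>i x. x \<in> D \<Longrightarrow> has_partial i (v1 i) (v2 i x) x"
    and pos: "\<And>x. x \<in> D \<Longrightarrow> 0 < (\<Sum>i\<in>UNIV. v2 i x)"
    and "x \<in> D"
  shows "v x \<le> 0"
proof -
  have "compact (closure D)" using D by simp
  moreover have "closure D \<noteq> {}" using \<open>x \<in> D\<close> by auto
  ultimately obtain z where z: "z \<in> closure D" "\<And>y. y \<in> closure D \<Longrightarrow> v y \<le> v z"
    using continuous_attains_sup[OF _ _ cont] by blast
  have "z \<notin> D"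
  proof
    assume "z \<in> D"
    have "v2 i z \<le> 0" for i
      using D(1) \<open>z \<in> D\<close> v1 v2[OF \<open>z \<in> D\<close>]
      by (rule second_partial_le_0_at_max) (use z closure_subset in auto)
    then have "(\<Sum>i\<in>UNIV. v2 i z) \<le> 0" by (intro sum_nonpos) auto
    with pos[OF \<open>z \<in> D\<close>] show False by simp
  qed
  then have "v z \<le> 0" using z(1) D(1) by (intro frontier) (simp add: frontier_def interior_open)
  with z(2)[of x] \<open>x \<in> D\<close> closure_subset show ?thesis by fastforce
qed

section \<open>Comparison with a function of the height\<close>

lemma Ck_on_2_has_partial:
  assumes "Ck_on 2 u S" "x \<in> S"
  shows "has_partial i u (partial i u x) x"
    and "has_partial i (partial i u) (partial i (partial i u) x) x"
  using assms by (auto simp: numeral_2_eq_2 intro!: has_partial_partial)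

text \<open>The function \<open>t\<close> measures the height above the boundary in a ball around the boundary point
  \<open>p\<close>; \<open>t1 i\<close> and \<open>t2 i\<close> are its first and second pure partial derivatives, \<open>P\<close> bounds \<open>|\<nabla> t|\<^sup>2\<close> and
  \<open>L\<close> bounds \<open>|\<Delta> t|\<close>.  Multiplying \<open>t\<close> by a positive constant only changes \<open>P\<close> and \<open>L\<close>, so the
  same setting serves for \<open>t\<close> and for \<open>A t\<close>; a lower bound for \<open>|\<nabla> t|\<close> would not have this invariance.\<close>

locale boundary_layer =
  fixes \<Omega> :: "(real ^ 'n) set" and p :: "real ^ 'n" and r P L :: real
    and t :: "real ^ 'n \<Rightarrow> real" and t1 t2 :: "'n \<Rightarrow> real ^ 'n \<Rightarrow> real"
  assumes open_dom: "open \<Omega>"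
    and center: "p \<in> frontier \<Omega>"
    and radius: "0 < r"
    and t_cont: "continuous_on (ball p r) t"
    and t_pos: "\<And>x. x \<in> \<Omega> \<Longrightarrow> x \<in> ball p r \<Longrightarrow> 0 < t x"
    and t_frontier: "\<And>x. x \<in> frontier \<Omega> \<Longrightarrow> x \<in> ball p r \<Longrightarrow> t x = 0"
    and t1: "\<And>i x. x \<in> ball p r \<Longrightarrow> has_partial i t (t1 i x) x"
    and t2: "\<And>i x. x \<in> ball p r \<Longrightarrow> has_partial i (t1 i) (t2 i x) x"
    and grad_le: "\<And>x. x \<in> ball p r \<Longrightarrow> (\<Sum>i\<in>UNIV. (t1 i x)\<^sup>2) \<le> P"
    and lap_le: "\<And>x. x \<in> ball p r \<Longrightarrow> \<bar>\<Sum>i\<in>UNIV. t2 i x\<bar> \<le> L"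
begin

text \<open>The function \<open>w(x) = \<psi>(t(x)) + M |x - x\<^sub>0|\<^sup>2\<close> satisfies \<open>\<Delta> w < \<Delta> u\<close> on the part \<open>D\<close> of
  \<open>\<Omega>\<close> that is closer to \<open>x\<^sub>0\<close> than \<open>\<rho>\<close> and lies below height \<open>\<tau>\<close>.  The frontier of \<open>D\<close> has
  three parts: \<open>bottom\<close> serves where it meets that of \<open>\<Omega>\<close>, \<open>side\<close> on the sphere, \<open>top\<close> at
  height \<open>\<tau>\<close>.  Centring the quadratic term at \<open>x\<^sub>0\<close> makes it disappear from the conclusion.\<close>

lemma barrier:
  assumes C2: "Ck_on 2 u \<Omega>"
    and cont: "continuous_on (closure \<Omega>) u"
    and zero: "\<And>x. x \<in> frontier \<Omega> \<Longrightarrow> u x = 0"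
    and x0: "x0 \<in> \<Omega>" "t x0 < \<tau>"
    and \<rho>: "0 < \<rho>" "cball x0 \<rho> \<subseteq> ball p r"
    and \<psi>_cont: "continuous_on {0..\<tau>} \<psi>"
    and \<psi>1: "\<And>y. 0 < y \<Longrightarrow> y < \<tau> \<Longrightarrow> (\<psi> has_real_derivative \<psi>1 y) (at y)"
    and \<psi>2: "\<And>y. 0 < y \<Longrightarrow> y < \<tau> \<Longrightarrow> (\<psi>1 has_real_derivative \<psi>2 y) (at y)"
    and bottom: "0 \<le> \<psi> 0" "0 \<le> M"
    and top: "\<And>x. x \<in> \<Omega> \<Longrightarrow> x \<in> cball x0 \<rho> \<Longrightarrow> t x = \<tau> \<Longrightarrow> u x \<le> \<psi> \<tau>"
    and side: "\<And>x. x \<in> \<Omega> \<Longrightarrow> dist x0 x = \<rho> \<Longrightarrow> t x \<le> \<tau> \<Longrightarrow> u x \<le> \<psi> (t x) + M * \<rho>\<^sup>2"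
    and ineq: "\<And>x. x \<in> \<Omega> \<Longrightarrow> x \<in> ball x0 \<rho> \<Longrightarrow> t x < \<tau> \<Longrightarrow>
      \<psi>2 (t x) * (\<Sum>i\<in>UNIV. (t1 i x)\<^sup>2) + \<psi>1 (t x) * (\<Sum>i\<in>UNIV. t2 i x) + 2 * M * CARD('n)
        < laplacian u x"
  shows "u x0 \<le> \<psi> (t x0)"
proof -
  define D where "D = \<Omega> \<inter> ball x0 \<rho> \<inter> t -` {..<\<tau>}"
  define w where "w x = \<psi> (t x) + M * (norm (x - x0))\<^sup>2" for x
  have sub: "ball x0 \<rho> \<subseteq> ball p r" using \<rho>(2) ball_subset_cball by blast
  have "continuous_on (\<Omega> \<inter> ball x0 \<rho>) t"
    using t_cont sub by (meson continuous_on_subset inf.coboundedI2)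
  then have "open D"
    unfolding D_def using open_dom by (intro continuous_open_preimage) auto
  have "bounded D" unfolding D_def by (meson bounded_ball bounded_subset inf.cobounded1 inf.cobounded2)
  have clD: "x \<in> closure \<Omega> \<and> x \<in> cball x0 \<rho> \<and> t x \<le> \<tau> \<and> 0 \<le> t x" if "x \<in> closure D" for x
  proof -
    have "continuous_on (cball x0 \<rho>) t" using t_cont \<rho>(2) continuous_on_subset by blast
    then have "closed (cball x0 \<rho> \<inter> t -` {..\<tau>})"
      by (intro continuous_closed_preimage) auto
    moreover have "D \<subseteq> cball x0 \<rho> \<inter> t -` {..\<tau>}" unfolding D_def by auto
    ultimately have "x \<in> cball x0 \<rho> \<inter> t -` {..\<tau>}" using that closure_minimal by blast
    moreover have "x \<in> closure \<Omega>" using that closure_mono[of D \<Omega>] by (auto simp: D_def)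
    moreover from this have "x \<in> \<Omega> \<or> x \<in> frontier \<Omega>" using open_dom
      by (simp add: frontier_def interior_open)
    ultimately show ?thesis using t_pos[of x] t_frontier[of x] \<rho>(2) by fastforce
  qed
  have "u x0 - w x0 \<le> 0"
  proof (rule weak_maximum_principle[OF \<open>open D\<close> \<open>bounded D\<close>])
    have "continuous_on (closure D) u"
      by (rule continuous_on_subset[OF cont]) (use clD in auto)
    moreover have "continuous_on (closure D) t"
      by (rule continuous_on_subset[OF t_cont]) (use clD \<rho>(2) in auto)
    moreover have "continuous_on (closure D) (\<lambda>x. \<psi> (t x))"
      by (rule continuous_on_compose2[OF \<psi>_cont \<open>continuous_on (closure D) t\<close>]) (use clD in auto)
    ultimately show "continuous_on (closure D) (\<lambda>x. u x - w x)"
      unfolding w_def by (intro continuous_intros)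
  next
    fix x assume "x \<in> frontier D"
    then have x: "x \<in> closure D" "x \<notin> D" using \<open>open D\<close> by (auto simp: frontier_def interior_open)
    note c = clD[OF x(1)]
    consider "x \<in> frontier \<Omega>" | "x \<in> \<Omega>" "dist x0 x = \<rho>" | "x \<in> \<Omega>" "t x = \<tau>"
      using x c open_dom by (force simp: D_def frontier_def interior_open)
    then show "u x - w x \<le> 0"
    proof cases
      case 1
      then have t: "t x = 0" using t_frontier c \<rho>(2) by blast
      have "0 \<le> M * (norm (x - x0))\<^sup>2" using bottom by simp
      then show ?thesis using zero[OF 1] bottom(1) unfolding w_def t by linarith
    next
      case 2
      then show ?thesis using side[OF 2] c by (simp add: w_def dist_norm norm_minus_commute)
    next
      case 3
      have "0 \<le> M * (norm (x - x0))\<^sup>2" using bottom by simp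
      then show ?thesis using top[OF 3(1) _ 3(2)] 3 c by (simp add: w_def)
    qed
  next
    show "has_partial i (\<lambda>x. u x - w x)
        (partial i u x - (\<psi>1 (t x) * t1 i x + M * (2 * (x $ i - x0 $ i)))) x" if "x \<in> D" for i x
      unfolding w_def
      by (intro has_partial_diff has_partial_add has_partial_cmult has_partial_norm_sq
          has_partial_compose \<psi>1 t1 Ck_on_2_has_partial[OF C2])
        (use that t_pos[of x] sub in \<open>auto simp: D_def\<close>)
    show "has_partial i (\<lambda>x. partial i u x - (\<psi>1 (t x) * t1 i x + M * (2 * (x $ i - x0 $ i))))
        (partial i (partial i u) x - ((\<psi>2 (t x) * t1 i x * t1 i x + t2 i x * \<psi>1 (t x)) + M * (2 * 1))) x"
      if "x \<in> D" for i x
      by (intro has_partial_diff has_partial_add has_partial_cmult has_partial_mult has_partial_nth_same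
          has_partial_compose \<psi>2 t1 t2 Ck_on_2_has_partial[OF C2])
        (use that t_pos[of x] sub in \<open>auto simp: D_def\<close>)
    show "0 < (\<Sum>i\<in>UNIV. partial i (partial i u) x - ((\<psi>2 (t x) * t1 i x * t1 i x + t2 i x * \<psi>1 (t x)) + M * (2 * 1)))"
      if "x \<in> D" for x
    proof -
      have "(\<Sum>i\<in>UNIV. partial i (partial i u) x - ((\<psi>2 (t x) * t1 i x * t1 i x + t2 i x * \<psi>1 (t x)) + M * (2 * 1)))
         = laplacian u x - (\<psi>2 (t x) * (\<Sum>i\<in>UNIV. (t1 i x)\<^sup>2) + \<psi>1 (t x) * (\<Sum>i\<in>UNIV. t2 i x) + 2 * M * CARD('n))"
        by (simp add: laplacian_def sum_subtractf sum.distrib sum_distrib_left power2_eq_square algebra_simps)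
      with ineq[of x] that show ?thesis by (simp add: D_def)
    qed
    show "x0 \<in> D" using x0 \<rho> by (simp add: D_def)
  qed
  then show ?thesis by (simp add: w_def)
qed

lemma L_nonneg: "0 \<le> L"
  using lap_le[of p] radius by auto

lemma P_nonneg: "0 \<le> P"
  using sum_nonneg[of UNIV "\<lambda>i. (t1 i p)\<^sup>2"] grad_le[of p] radius by simp

text \<open>The barrier is \<open>\<psi>(y) = 2 B \<tau> y - B y\<^sup>2\<close>, which increases from \<open>0\<close> to \<open>B \<tau>\<^sup>2\<close> on \<open>[0, \<tau>]\<close>.
  Its concavity contributes \<open>-2 B |\<nabla> t|\<^sup>2 \<le> -2 B\<close> to the Laplacian.  For small \<open>\<tau>\<close> the term
  \<open>\<psi>' \<Delta> t\<close> uses up at most half of this, and a large \<open>B\<close> beats what remains.\<close>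

lemma linear_upper_bound:
  assumes C2: "Ck_on 2 u \<Omega>"
    and cont: "continuous_on (closure \<Omega>) u"
    and zero: "\<And>x. x \<in> frontier \<Omega> \<Longrightarrow> u x = 0"
    and grad_ge: "\<And>x. x \<in> ball p r \<Longrightarrow> 1 \<le> (\<Sum>i\<in>UNIV. (t1 i x)\<^sup>2)"
    and S: "0 \<le> S" "\<And>x. x \<in> \<Omega> \<Longrightarrow> u x \<le> S"
    and C: "0 \<le> C" "\<And>x. x \<in> \<Omega> \<Longrightarrow> - C \<le> laplacian u x"
  shows "\<exists>A>0. \<forall>x\<in>\<Omega> \<inter> ball p (r/2). u x \<le> A * t x"
proof -
  define \<rho> \<tau> where "\<rho> = r / 4" and "\<tau> = 1 / (2 * (L + 1))"
  define M where "M = S / \<rho>\<^sup>2"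
  define B where "B = S / \<tau>\<^sup>2 + 2 * M * CARD('n) + C + 1"
  define \<psi> where "\<psi> y = 2 * B * \<tau> * y - B * y\<^sup>2" for y
  have \<rho>: "0 < \<rho>" using radius by (simp add: \<rho>_def)
  have \<tau>: "0 < \<tau>" "\<tau> * L \<le> 1 / 2" using L_nonneg by (auto simp: \<tau>_def field_simps)
  have M: "0 \<le> M" "M * \<rho>\<^sup>2 = S" using S \<rho> by (auto simp: M_def)
  have "0 \<le> S / \<tau>\<^sup>2" "0 \<le> 2 * M * CARD('n)" using S M by auto
  then have B: "0 < B" "B \<ge> 2 * M * CARD('n) + C + 1" "S / \<tau>\<^sup>2 \<le> B"
    unfolding B_def using C(1) by linarith+
  have BS: "S \<le> B * \<tau>\<^sup>2" using B(3) \<tau> by (simp add: field_simps)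
  have "u x0 \<le> 2 * B * \<tau> * t x0" if x0: "x0 \<in> \<Omega>" "x0 \<in> ball p (r/2)" for x0
  proof (cases "t x0 < \<tau>")
    case True
    have sub: "cball x0 \<rho> \<subseteq> ball p r"
    proof
      fix y assume "y \<in> cball x0 \<rho>"
      then show "y \<in> ball p r" using x0 dist_triangle[of p y x0] radius by (simp add: \<rho>_def)
    qed
    have "u x0 \<le> \<psi> (t x0)"
    proof (rule barrier[OF C2 cont zero x0(1) True \<rho> sub])
      show "continuous_on {0..\<tau>} \<psi>" unfolding \<psi>_def by (intro continuous_intros)
      show "(\<psi> has_real_derivative 2 * B * \<tau> - 2 * B * y) (at y)" for y
        unfolding \<psi>_def by (auto intro!: derivative_eq_intros)
      show "((\<lambda>y. 2 * B * \<tau> - 2 * B * y) has_real_derivative - 2 * B) (at y)" for y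
        by (auto intro!: derivative_eq_intros)
      show "0 \<le> \<psi> 0" "0 \<le> M" using M by (auto simp: \<psi>_def)
      show "u x \<le> \<psi> \<tau>" if "x \<in> \<Omega>" for x
        using S(2)[OF that] BS by (simp add: \<psi>_def power2_eq_square)
      show "u x \<le> \<psi> (t x) + M * \<rho>\<^sup>2" if "x \<in> \<Omega>" "dist x0 x = \<rho>" "t x \<le> \<tau>" for x
      proof -
        have "0 < t x" using that sub by (intro t_pos) auto
        then have "0 \<le> B * t x * (2 * \<tau> - t x)" using that B by simp
        also have "\<dots> = \<psi> (t x)" by (simp add: \<psi>_def power2_eq_square algebra_simps)
        finally show ?thesis using S(2)[OF that(1)] M by simp
      qed
      show "- 2 * B * (\<Sum>i\<in>UNIV. (t1 i x)\<^sup>2) + (2 * B * \<tau> - 2 * B * t x) * (\<Sum>i\<in>UNIV. t2 i x) +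
          2 * M * CARD('n) < laplacian u x"
        if "x \<in> \<Omega>" "x \<in> ball x0 \<rho>" "t x < \<tau>" for x
      proof -
        have x: "x \<in> ball p r" using that(2) sub ball_subset_cball by blast
        have "- 2 * B * (\<Sum>i\<in>UNIV. (t1 i x)\<^sup>2) \<le> - 2 * B"
          using mult_left_mono[OF grad_ge[OF x], of "2 * B"] B by simp
        moreover have "(2 * B * \<tau> - 2 * B * t x) * (\<Sum>i\<in>UNIV. t2 i x) \<le> (2 * B * \<tau>) * L"
        proof -
          have "0 < t x" using t_pos that x by blast
          have "(2 * B * \<tau> - 2 * B * t x) * (\<Sum>i\<in>UNIV. t2 i x) \<le> (2 * B * \<tau> - 2 * B * t x) * L"
            using lap_le[OF x] that B by (intro mult_left_mono) auto
          also have "\<dots> \<le> (2 * B * \<tau>) * L"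
            using \<open>0 < t x\<close> B L_nonneg by (intro mult_right_mono) auto
          finally show ?thesis .
        qed
        moreover have "(2 * B * \<tau>) * L \<le> B"
          using mult_left_mono[OF \<tau>(2), of "2 * B"] B by (simp add: algebra_simps)
        ultimately show ?thesis using C(2)[OF that(1)] B(2) by linarith
      qed
    qed
    also have "\<dots> \<le> 2 * B * \<tau> * t x0" using B by (simp add: \<psi>_def)
    finally show ?thesis .
  next
    case False
    have "S \<le> B * \<tau> * \<tau>" using BS by (simp add: power2_eq_square)
    also have "\<dots> \<le> 2 * B * \<tau> * t x0" using False B \<tau> by (intro mult_mono) auto
    finally show ?thesis using S(2)[OF x0(1)] by simp
  qed
  then show ?thesis using B \<tau> by (intro exI[of _ "2 * B * \<tau>"]) auto
qed

end

section \<open>A convex profile with negative initial slope\<close>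

lemma unbounded_integral_at_0:
  fixes g :: "real \<Rightarrow> real"
  assumes cont: "continuous_on {0<..} g"
    and nonneg: "\<And>s. 0 < s \<Longrightarrow> 0 \<le> g s"
    and infinite: "(\<integral>\<^sup>+ s \<in> {0<..<1}. ennreal (g s) \<partial>lborel) = \<infinity>"
    and \<tau>: "0 < \<tau>"
  shows "\<exists>\<epsilon>. 0 < \<epsilon> \<and> \<epsilon> < \<tau> \<and> B \<le> integral {\<epsilon>..\<tau>} g"
proof (rule ccontr)
  assume "\<not> ?thesis"
  then have bound: "integral {\<epsilon>..\<tau>} g \<le> B" if "0 < \<epsilon>" "\<epsilon> < \<tau>" for \<epsilon> using that by force
  have Icc: "(\<integral>\<^sup>+s. ennreal (g s) * indicator {c..d} s \<partial>lborel) = ennreal (integral {c..d} g)"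
    if "0 < c" for c d
  proof (rule nn_integral_has_integral_lebesgue')
    have "continuous_on {c..d} g" using cont by (rule continuous_on_subset) (use that in auto)
    then show "(g has_integral integral {c..d} g) {c..d}"
      using integrable_continuous_interval integrable_integral by blast
  qed (use that nonneg in auto)
  define c where "c n = \<tau> / real (n + 2)" for n
  have c: "0 < c n" "c n < \<tau>" for n using \<tau> by (auto simp: c_def field_simps add_pos_nonneg)
  define F where "F n s = ennreal (g s) * indicator {c n..\<tau>} s" for n s
  have c_mono: "c n \<le> c m" if "m \<le> n" for m n
    unfolding c_def using \<tau> that by (intro divide_left_mono) auto
  have "incseq F"
    unfolding incseq_def le_fun_def F_def using order_trans[OF c_mono]
    by (auto intro!: mult_left_mono simp: indicator_def)
  have meas: "(\<lambda>s. ennreal (g s) * indicator A s) \<in> borel_measurable lborel"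
    if "A \<in> sets borel" "A \<subseteq> {0<..}" for A
  proof -
    have "(\<lambda>s. indicator A s *\<^sub>R g s) \<in> borel_measurable borel"
      using that continuous_on_subset[OF cont] by (intro borel_measurable_continuous_on_indicator) auto
    then have "(\<lambda>s. ennreal (indicator A s *\<^sub>R g s)) \<in> borel_measurable borel"
      by (rule measurable_compose) simp
    moreover have "(\<lambda>s. ennreal (g s) * indicator A s) = (\<lambda>s. ennreal (indicator A s *\<^sub>R g s))"
      by (auto simp: indicator_def)
    ultimately show ?thesis by simp
  qed
  have F_meas: "F n \<in> borel_measurable lborel" for n
    unfolding F_def by (rule meas) (use c[of n] in auto)
  have "ennreal (g s) * indicator {0<..\<tau>} s \<le> (SUP n. F n s)" for s
  proof (cases "s \<in> {0<..\<tau>}")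
    case s: True
    obtain n where "\<tau> / s < real n" using reals_Archimedean2 by blast
    then have "\<tau> \<le> s * (real n + 2)" using s by (simp add: field_simps)
    then have "c n \<le> s" by (simp add: c_def field_simps)
    with s show ?thesis by (intro SUP_upper2[of n]) (auto simp: F_def)
  qed simp
  then have "(\<integral>\<^sup>+s. ennreal (g s) * indicator {0<..\<tau>} s \<partial>lborel) \<le> (\<integral>\<^sup>+s. (SUP n. F n s) \<partial>lborel)"
    by (rule nn_integral_mono)
  also have "\<dots> = (SUP n. \<integral>\<^sup>+s. F n s \<partial>lborel)"
    by (rule nn_integral_monotone_convergence_SUP[OF \<open>incseq F\<close> F_meas])
  also have "\<dots> \<le> ennreal B"
    unfolding F_def using bound[OF c] by (intro SUP_least) (simp add: Icc[OF c(1)] ennreal_leI)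
  finally have near: "(\<integral>\<^sup>+s. ennreal (g s) * indicator {0<..\<tau>} s \<partial>lborel) \<le> ennreal B" .
  have "(\<integral>\<^sup>+s. ennreal (g s) * indicator {0<..<1} s \<partial>lborel)
      \<le> (\<integral>\<^sup>+s. ennreal (g s) * indicator {0<..\<tau>} s + ennreal (g s) * indicator {\<tau>..1} s \<partial>lborel)"
    by (intro nn_integral_mono) (auto simp: indicator_def)
  also have "\<dots> \<le> ennreal B + ennreal (integral {\<tau>..1} g)"
  proof (subst nn_integral_add)
    show "(\<integral>\<^sup>+s. ennreal (g s) * indicator {0<..\<tau>} s \<partial>lborel) + (\<integral>\<^sup>+s. ennreal (g s) * indicator {\<tau>..1} s \<partial>lborel)
        \<le> ennreal B + ennreal (integral {\<tau>..1} g)"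
      using near Icc[OF \<tau>, of 1] by (intro add_mono) auto
  qed (rule meas; use \<tau> in auto)+
  also have "\<dots> < \<infinity>" by simp
  finally show False using infinite by simp
qed

text \<open>The second derivative \<open>h\<close> is a continuous truncation of \<open>g\<close>, supported in \<open>[0, \<tau>/2]\<close> and scaled
  to have integral exactly \<open>4\<close>; divergence of the integral of \<open>g\<close> at \<open>0\<close> makes the scaling factor at
  most \<open>b\<close>.  Hence the slope rises from \<open>-1\<close> at \<open>0\<close> to \<open>3\<close> at \<open>\<tau>/2\<close> and stays there.
  So \<open>\<psi>(\<tau>) \<ge> -\<tau>/2 + 3 \<tau>/2 = \<tau>\<close>: this is how \<open>\<psi>\<close> can begin below \<open>0\<close> and yet dominate a function
  that is at most \<open>t\<close> where \<open>t = \<tau>\<close>.  The bounds \<open>-1\<close> and \<open>3\<close> are independent of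
  \<open>\<tau>\<close>, so \<open>\<tau>\<close> can be chosen after every constant that depends on \<open>\<psi>\<close> and \<open>\<psi>'\<close>.\<close>

lemma convex_profile:
  fixes g :: "real \<Rightarrow> real"
  assumes cont: "continuous_on {0<..} g"
    and nonneg: "\<And>s. 0 < s \<Longrightarrow> 0 \<le> g s"
    and anti: "antimono_on {0<..} g"
    and div: "\<And>\<sigma> B. 0 < \<sigma> \<Longrightarrow> \<exists>\<epsilon>. 0 < \<epsilon> \<and> \<epsilon> < \<sigma> \<and> B \<le> integral {\<epsilon>..\<sigma>} g"
    and b: "0 < b" and \<tau>: "0 < \<tau>" "\<tau> \<le> 1"
  obtains \<psi> \<psi>1 h \<eta> where
    "continuous_on {0..\<tau>} \<psi>"
    "\<And>y. 0 < y \<Longrightarrow> y < \<tau> \<Longrightarrow> (\<psi> has_real_derivative \<psi>1 y) (at y)"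
    "\<And>y. 0 < y \<Longrightarrow> y < \<tau> \<Longrightarrow> (\<psi>1 has_real_derivative h y) (at y)"
    "\<psi> 0 = 0" "\<tau> \<le> \<psi> \<tau>"
    "\<And>y. 0 \<le> y \<Longrightarrow> y \<le> \<tau> \<Longrightarrow> - 1 \<le> \<psi> y"
    "\<And>y. 0 < y \<Longrightarrow> y < \<tau> \<Longrightarrow> \<bar>\<psi>1 y\<bar> \<le> 3"
    "\<And>y. 0 < y \<Longrightarrow> 0 \<le> h y" "\<And>y. 0 < y \<Longrightarrow> h y \<le> b * g y"
    "0 < \<eta>" "\<And>y. 0 < y \<Longrightarrow> y < \<eta> \<Longrightarrow> y \<le> \<tau> \<Longrightarrow> \<psi> y < 0"
proof -
  define \<sigma> where "\<sigma> = \<tau> / 2"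
  have \<sigma>: "0 < \<sigma>" "\<sigma> < \<tau>" "\<sigma> \<le> 1" using \<tau> by (auto simp: \<sigma>_def)
  obtain \<epsilon> where \<epsilon>: "0 < \<epsilon>" "\<epsilon> < \<sigma>" "4 / b + g \<sigma> \<le> integral {\<epsilon>..\<sigma>} g"
    using div[OF \<sigma>(1)] by blast
  \<comment> \<open>Freezing the argument at \<open>\<epsilon>\<close> removes the singularity; subtracting \<open>g \<sigma>\<close> makes the cut-off
    at \<open>\<sigma>\<close> continuous.  The extra \<open>g \<sigma>\<close> in the choice of \<open>\<epsilon>\<close> pays for this subtraction.\<close>
  define G where "G s = max 0 (g (max s \<epsilon>) - g \<sigma>)" for s
  have G_cont: "continuous_on S G" for S
    unfolding G_def
    by (intro continuous_intros continuous_on_compose2[OF cont]) (use \<epsilon> in auto)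
  have G_int: "G integrable_on {c..d}" for c d
    using G_cont by (rule integrable_continuous_interval)
  have G_nonneg: "0 \<le> G s" for s by (simp add: G_def)
  have G_le: "G s \<le> g s" if "0 < s" for s
    using that nonneg[of s] nonneg[OF \<sigma>(1)] \<epsilon> monotone_onD[OF anti, of s "max s \<epsilon>"]
    by (simp add: G_def)
  have G_0: "G s = 0" if "\<sigma> \<le> s" for s
    using that \<sigma>(1) \<epsilon> monotone_onD[OF anti, of \<sigma> s] by (simp add: G_def max_def)
  define I where "I = integral {0..\<tau>} G"
  have "4 / b \<le> I"
  proof -
    have ge: "g integrable_on {\<epsilon>..\<sigma>}"
      by (intro integrable_continuous_interval continuous_on_subset[OF cont]) (use \<epsilon> in auto)
    have "4 / b \<le> integral {\<epsilon>..\<sigma>} g - g \<sigma> * (\<sigma> - \<epsilon>)"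
      using \<epsilon> \<sigma> nonneg[OF \<sigma>(1)] mult_left_mono[of "\<sigma> - \<epsilon>" 1 "g \<sigma>"] by simp
    also have "\<dots> = integral {\<epsilon>..\<sigma>} (\<lambda>s. g s - g \<sigma>)"
      using \<epsilon> ge by (subst integral_diff) auto
    also have "\<dots> \<le> integral {\<epsilon>..\<sigma>} G"
      using ge by (intro integral_le integrable_diff G_int) (auto simp: G_def)
    also have "\<dots> \<le> I"
      unfolding I_def by (intro integral_subset_le G_int) (use \<epsilon> \<sigma> G_nonneg in auto)
    finally show ?thesis .
  qed
  moreover have "0 < 4 / b" using b by simp
  ultimately have "0 < I" by linarith
  with \<open>4 / b \<le> I\<close> have I: "0 < I" "4 / I \<le> b" using b by (auto simp: field_simps)
  define h where "h s = 4 / I * G s" for s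
  have h_cont: "continuous_on S h" for S unfolding h_def by (intro continuous_intros G_cont)
  have h_int: "h integrable_on {c..d}" for c d
    using h_cont by (rule integrable_continuous_interval)
  have h_nonneg: "0 \<le> h s" for s using I G_nonneg by (simp add: h_def)
  have h_le: "h s \<le> b * g s" if "0 < s" for s
    unfolding h_def using I G_nonneg G_le[OF that] b by (intro mult_mono) auto
  define \<psi>1 where "\<psi>1 y = integral {0..y} h - 1" for y
  define \<psi> where "\<psi> y = integral {0..y} \<psi>1" for y
  have total: "integral {0..\<tau>} h = 4" unfolding h_def using I by (simp add: I_def[symmetric])
  have \<psi>1_ge: "- 1 \<le> \<psi>1 y" for y
    unfolding \<psi>1_def using integral_nonneg[OF h_int, of 0 y] h_nonneg by simp
  have \<psi>1_le: "\<psi>1 y \<le> 3" if "y \<le> \<tau>" for y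
    using integral_subset_le[OF _ h_int h_int, of 0 y 0 \<tau>] total that h_nonneg
    by (simp add: \<psi>1_def)
  have \<psi>1_eq: "\<psi>1 y = 3" if "\<sigma> \<le> y" "y \<le> \<tau>" for y
  proof -
    have "integral {0..y} h + integral {y..\<tau>} h = integral {0..\<tau>} h"
      by (intro Henstock_Kurzweil_Integration.integral_combine h_int) (use that \<sigma> in auto)
    moreover have "integral {y..\<tau>} h = integral {y..\<tau>} (\<lambda>_. 0)"
      by (intro integral_cong) (use that G_0 in \<open>auto simp: h_def\<close>)
    ultimately show ?thesis by (simp add: \<psi>1_def total)
  qed
  have d1: "(\<psi>1 has_real_derivative h y) (at y within {0..\<tau>})" if "0 \<le> y" "y \<le> \<tau>" for y
    unfolding \<psi>1_def
    using DERIV_diff[OF integral_has_real_derivative[OF h_cont, of y 0 \<tau>] DERIV_const[of 1]] that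
    by simp
  have \<psi>1_cont: "continuous_on {0..\<tau>} \<psi>1"
    by (rule DERIV_continuous_on[OF d1]) auto
  have \<psi>1_int: "\<psi>1 integrable_on {c..d}" if "0 \<le> c" "d \<le> \<tau>" for c d
    by (intro integrable_continuous_interval continuous_on_subset[OF \<psi>1_cont]) (use that in auto)
  have d0: "(\<psi> has_real_derivative \<psi>1 y) (at y within {0..\<tau>})" if "0 \<le> y" "y \<le> \<tau>" for y
    unfolding \<psi>_def using integral_has_real_derivative[OF \<psi>1_cont, of y] that by simp
  have at: "at y within {0..\<tau>} = at y" if "0 < y" "y < \<tau>" for y
    using that by (simp add: at_within_Icc_at)
  have \<psi>_ge: "- y \<le> \<psi> y" if "0 \<le> y" "y \<le> \<tau>" for y
    using integral_le[of "\<lambda>_. - 1" "{0..y}" \<psi>1, OF integrable_const_ivl] \<psi>1_int[of 0 y] \<psi>1_ge that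
    by (simp add: \<psi>_def)
  have \<psi>_\<tau>: "\<tau> \<le> \<psi> \<tau>"
  proof -
    have "\<psi> \<sigma> + integral {\<sigma>..\<tau>} \<psi>1 = \<psi> \<tau>"
      unfolding \<psi>_def
      by (intro Henstock_Kurzweil_Integration.integral_combine \<psi>1_int) (use \<sigma> in auto)
    moreover have "integral {\<sigma>..\<tau>} \<psi>1 = integral {\<sigma>..\<tau>} (\<lambda>_. 3)"
      by (intro integral_cong) (use \<psi>1_eq in auto)
    ultimately show ?thesis using \<psi>_ge[of \<sigma>] \<sigma> by (simp add: \<sigma>_def)
  qed
  have \<psi>0: "\<psi> 0 = 0" "\<psi>1 0 = - 1" by (simp_all add: \<psi>_def \<psi>1_def)
  obtain \<eta> where \<eta>: "0 < \<eta>" "\<And>y. 0 < y \<Longrightarrow> 0 + y \<in> {0..\<tau>} \<Longrightarrow> y < \<eta> \<Longrightarrow> \<psi> (0 + y) < \<psi> 0"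
    using has_real_derivative_neg_dec_right[OF d0[of 0]] \<tau> \<psi>0 by auto
  show ?thesis
  proof (rule that[of \<psi> \<psi>1 h \<eta>])
    show "continuous_on {0..\<tau>} \<psi>" by (rule DERIV_continuous_on[OF d0]) auto
    show "(\<psi> has_real_derivative \<psi>1 y) (at y)" "(\<psi>1 has_real_derivative h y) (at y)"
      if "0 < y" "y < \<tau>" for y using d0[of y] d1[of y] at[OF that] that by auto
    show "- 1 \<le> \<psi> y" if "0 \<le> y" "y \<le> \<tau>" for y using \<psi>_ge[OF that] that \<tau> by simp
    show "\<bar>\<psi>1 y\<bar> \<le> 3" if "0 < y" "y < \<tau>" for y using \<psi>1_ge[of y] \<psi>1_le[of y] that by auto
    show "\<psi> y < 0" if "0 < y" "y < \<eta>" "y \<le> \<tau>" for y using \<eta>(2)[of y] that \<psi>0 by simp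
  qed (use \<psi>0 \<psi>_\<tau> h_nonneg h_le \<eta> in auto)
qed

section \<open>Nonexistence in a boundary layer\<close>

context boundary_layer
begin

text \<open>The assumption \<open>u \<le> t\<close> bounds the singular term below by \<open>k g(t)\<close>.  One half of this
  absorbs \<open>\<psi>'' |\<nabla> t|\<^sup>2\<close>, the other half exceeds all the bounded terms if \<open>t < \<tau>\<close> with \<open>\<tau>\<close> small.\<close>

lemma no_subsolution_below_t:
  fixes g :: "real \<Rightarrow> real"
  assumes C2: "Ck_on 2 u \<Omega>"
    and cont: "continuous_on (closure \<Omega>) u"
    and zero: "\<And>x. x \<in> frontier \<Omega> \<Longrightarrow> u x = 0"
    and pos: "\<And>x. x \<in> \<Omega> \<Longrightarrow> 0 < u x"
    and le: "\<And>x. x \<in> \<Omega> \<Longrightarrow> x \<in> ball p r \<Longrightarrow> u x \<le> t x"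
    and S: "0 \<le> S" "\<And>x. x \<in> \<Omega> \<Longrightarrow> u x \<le> S"
    and k: "0 < k"
    and lap: "\<And>x. x \<in> \<Omega> \<Longrightarrow> k * g (u x) - C \<le> laplacian u x"
    and g_cont: "continuous_on {0<..} g"
    and g_nonneg: "\<And>s. 0 < s \<Longrightarrow> 0 \<le> g s"
    and g_anti: "antimono_on {0<..} g"
    and g_zero: "filterlim g at_top (at_right 0)"
    and g_div: "\<And>\<sigma> B. 0 < \<sigma> \<Longrightarrow> \<exists>\<epsilon>. 0 < \<epsilon> \<and> \<epsilon> < \<sigma> \<and> B \<le> integral {\<epsilon>..\<sigma>} g"
  shows False
proof -
  define \<rho> where "\<rho> = r / 4"
  \<comment> \<open>The profile may fall to \<open>-1\<close>, hence \<open>S + 1\<close> on the sphere.\<close>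
  define M where "M = (S + 1) / \<rho>\<^sup>2"
  define H where "H = C + 3 * L + 2 * M * CARD('n)"
  define b where "b = k / (2 * (P + 1))"
  have \<rho>: "0 < \<rho>" using radius by (simp add: \<rho>_def)
  have M: "0 \<le> M" "M * \<rho>\<^sup>2 = S + 1" using S \<rho> by (auto simp: M_def)
  have b: "0 < b" "b * P \<le> k / 2" using k P_nonneg by (auto simp: b_def field_simps)
  have "\<forall>\<^sub>F s in at_right 0. 2 * H / k < g s"
    using g_zero by (simp add: filterlim_at_top_dense)
  then obtain \<tau>0 where \<tau>0: "0 < \<tau>0" "\<And>s. 0 < s \<Longrightarrow> s < \<tau>0 \<Longrightarrow> 2 * H / k < g s"
    unfolding eventually_at_right_field by blast
  define \<tau> where "\<tau> = min 1 \<tau>0"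
  have \<tau>: "0 < \<tau>" "\<tau> \<le> 1" "\<tau> \<le> \<tau>0" using \<tau>0 by (auto simp: \<tau>_def)
  obtain \<psi> \<psi>1 h \<eta> where \<psi>:
    "continuous_on {0..\<tau>} \<psi>"
    "\<And>y. 0 < y \<Longrightarrow> y < \<tau> \<Longrightarrow> (\<psi> has_real_derivative \<psi>1 y) (at y)"
    "\<And>y. 0 < y \<Longrightarrow> y < \<tau> \<Longrightarrow> (\<psi>1 has_real_derivative h y) (at y)"
    "\<psi> 0 = 0" "\<tau> \<le> \<psi> \<tau>"
    "\<And>y. 0 \<le> y \<Longrightarrow> y \<le> \<tau> \<Longrightarrow> - 1 \<le> \<psi> y"
    "\<And>y. 0 < y \<Longrightarrow> y < \<tau> \<Longrightarrow> \<bar>\<psi>1 y\<bar> \<le> 3"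
    "\<And>y. 0 < y \<Longrightarrow> 0 \<le> h y" "\<And>y. 0 < y \<Longrightarrow> h y \<le> b * g y"
    "0 < \<eta>" "\<And>y. 0 < y \<Longrightarrow> y < \<eta> \<Longrightarrow> y \<le> \<tau> \<Longrightarrow> \<psi> y < 0"
    by (rule convex_profile[OF g_cont g_nonneg g_anti g_div b(1) \<tau>(1,2)]) (assumption | rule that)+
  \<comment> \<open>Any point of \<open>\<Omega>\<close> so close to \<open>p\<close> that its height is below \<open>\<eta>\<close> yields the contradiction.\<close>
  have "isCont t p" using t_cont radius by (simp add: continuous_on_eq_continuous_at)
  moreover have "t p = 0" using t_frontier center radius by simp
  ultimately obtain \<delta> where \<delta>: "0 < \<delta>" "\<And>x. dist x p < \<delta> \<Longrightarrow> \<bar>t x\<bar> < min \<eta> \<tau>"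
    using \<psi>(10) \<tau>(1) unfolding continuous_at_eps_delta
    by (elim allE[of _ "min \<eta> \<tau>"]) (auto simp: dist_real_def)
  have "p \<in> closure \<Omega>" using center by (simp add: frontier_def)
  then obtain x0 where x0: "x0 \<in> \<Omega>" "dist x0 p < min \<delta> (r / 2)"
    using \<delta>(1) radius unfolding closure_approachable by (elim allE[of _ "min \<delta> (r / 2)"]) auto
  have sub: "cball x0 \<rho> \<subseteq> ball p r"
  proof
    fix y assume "y \<in> cball x0 \<rho>"
    then show "y \<in> ball p r"
      using x0 dist_triangle[of p y x0] radius by (simp add: \<rho>_def dist_commute)
  qed
  have t0: "0 < t x0" "t x0 < \<eta>" "t x0 < \<tau>"
    using \<delta>(2)[of x0] x0 t_pos[of x0] radius by (auto simp: dist_commute)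
  have "u x0 \<le> \<psi> (t x0)"
  proof (rule barrier[OF C2 cont zero x0(1) t0(3) \<rho> sub \<psi>(1-3)])
    show "0 \<le> \<psi> 0" "0 \<le> M" using M \<psi>(4) by auto
    show "u x \<le> \<psi> \<tau>" if "x \<in> \<Omega>" "x \<in> cball x0 \<rho>" "t x = \<tau>" for x
      using le[of x] that sub \<psi>(5) by auto
    show "u x \<le> \<psi> (t x) + M * \<rho>\<^sup>2" if "x \<in> \<Omega>" "dist x0 x = \<rho>" "t x \<le> \<tau>" for x
    proof -
      have "0 < t x" using that sub by (intro t_pos) auto
      then show ?thesis using \<psi>(6)[of "t x"] that S(2)[OF that(1)] M by simp
    qed
    show "h (t x) * (\<Sum>i\<in>UNIV. (t1 i x)\<^sup>2) + \<psi>1 (t x) * (\<Sum>i\<in>UNIV. t2 i x) +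
        2 * M * CARD('n) < laplacian u x"
      if "x \<in> \<Omega>" "x \<in> ball x0 \<rho>" "t x < \<tau>" for x
    proof -
      have x: "x \<in> ball p r" using that(2) sub ball_subset_cball by blast
      then have tx: "0 < t x" using t_pos that by blast
      have "h (t x) * (\<Sum>i\<in>UNIV. (t1 i x)\<^sup>2) \<le> (b * g (t x)) * P"
        using \<psi>(8,9)[OF tx] grad_le[OF x] P_nonneg by (intro mult_mono) (auto intro: sum_nonneg)
      also have "\<dots> \<le> k / 2 * g (t x)"
        using mult_right_mono[OF b(2) g_nonneg[OF tx]] by (simp add: algebra_simps)
      finally have 1: "h (t x) * (\<Sum>i\<in>UNIV. (t1 i x)\<^sup>2) \<le> k / 2 * g (t x)" .
      have "\<bar>\<psi>1 (t x) * (\<Sum>i\<in>UNIV. t2 i x)\<bar> \<le> 3 * L"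
        unfolding abs_mult using \<psi>(7)[OF tx] that lap_le[OF x] by (intro mult_mono) auto
      then have 2: "\<psi>1 (t x) * (\<Sum>i\<in>UNIV. t2 i x) \<le> 3 * L" by linarith
      have 3: "H < k / 2 * g (t x)" using \<tau>0(2)[OF tx] that \<tau> k by (simp add: field_simps)
      have "g (t x) \<le> g (u x)"
        using monotone_onD[OF g_anti, of "u x" "t x"] le[OF that(1) x] pos[OF that(1)] tx by simp
      then have "k * g (t x) \<le> k * g (u x)" using k by simp
      with 1 2 3 lap[OF that(1)] show ?thesis by (simp add: H_def)
    qed
  qed
  also have "\<dots> < 0" using \<psi>(11) t0 by auto
  finally show False using pos[OF x0(1)] by simp
qed

lemma scaled:
  assumes "0 < A" "0 < r'" "r' \<le> r"
  shows "boundary_layer \<Omega> p r' (A\<^sup>2 * P) (A * L) (\<lambda>x. A * t x) (\<lambda>i x. A * t1 i x) (\<lambda>i x. A * t2 i x)"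
proof
  have sub: "ball p r' \<subseteq> ball p r" using assms by auto
  show "continuous_on (ball p r') (\<lambda>x. A * t x)"
    using continuous_on_subset[OF t_cont sub] by (intro continuous_intros)
  show "0 < A * t x" if "x \<in> \<Omega>" "x \<in> ball p r'" for x
    using t_pos that sub assms by auto
  show "A * t x = 0" if "x \<in> frontier \<Omega>" "x \<in> ball p r'" for x
    using t_frontier that sub by auto
  show "has_partial i (\<lambda>x. A * t x) (A * t1 i x) x" "has_partial i (\<lambda>x. A * t1 i x) (A * t2 i x) x"
    if "x \<in> ball p r'" for i x
    using t1 t2 that sub by (blast intro: has_partial_cmult)+
  fix x assume "x \<in> ball p r'"
  then have x: "x \<in> ball p r" using sub by blast
  show "(\<Sum>i\<in>UNIV. (A * t1 i x)\<^sup>2) \<le> A\<^sup>2 * P"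
    using grad_le[OF x] assms by (simp add: power_mult_distrib flip: sum_distrib_left)
  show "\<bar>\<Sum>i\<in>UNIV. A * t2 i x\<bar> \<le> A * L"
    using lap_le[OF x] assms by (simp add: abs_mult flip: sum_distrib_left)
qed (use open_dom center assms in auto)

end

section \<open>Straightening the boundary\<close>

lemma continuous_on_compact_abs_le:
  fixes h :: "'a::metric_space \<Rightarrow> real"
  assumes "compact S" "continuous_on S h"
  obtains B where "0 \<le> B" "\<And>x. x \<in> S \<Longrightarrow> \<bar>h x\<bar> \<le> B"
  using compact_imp_bounded[OF compact_continuous_image[OF assms(2,1)]]
  unfolding bounded_pos by (auto intro: less_imp_le)

lemma holder_on_imp_continuous_on:
  assumes h: "holder_on \<alpha> S h" and \<alpha>: "0 < \<alpha>"
  shows "continuous_on S h"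
proof -
  obtain C where C: "\<And>x y. x \<in> S \<Longrightarrow> y \<in> S \<Longrightarrow> dist (h x) (h y) \<le> C * dist x y powr \<alpha>"
    using h unfolding holder_on_def by blast
  show ?thesis
    unfolding continuous_on_def
  proof
    fix x assume x: "x \<in> S"
    have "((\<lambda>y. C * dist y x powr \<alpha>) \<longlongrightarrow> C * 0 powr \<alpha>) (at x within S)"
      by (intro tendsto_intros tendsto_powr2) 
        (use \<alpha> in \<open>auto intro!: tendsto_eq_intros simp: eventually_at_filter\<close>)
    then have "((\<lambda>y. C * dist y x powr \<alpha>) \<longlongrightarrow> 0) (at x within S)" by simp
    moreover have "\<forall>\<^sub>F y in at x within S. norm (dist (h y) (h x)) \<le> C * dist y x powr \<alpha>"
      using C x by (auto simp: eventually_at_filter)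
    ultimately have "((\<lambda>y. dist (h y) (h x)) \<longlongrightarrow> 0) (at x within S)"
      by (rule Lim_null_comparison[rotated])
    then show "(h \<longlongrightarrow> h x) (at x within S)" by (rule tendsto_dist_iff[THEN iffD2])
  qed
qed

text \<open>The height is \<open>t = \<sigma> x\<^sub>k - \<phi>\<close>.  Since \<open>\<phi>\<close> does not depend on \<open>x\<^sub>k\<close>, the \<open>k\<close>-th partial
  derivative of \<open>t\<close> is \<open>\<sigma> = \<plusminus>1\<close>, whence \<open>|\<nabla> t| \<ge> 1\<close>.\<close>

lemma exists_boundary_layer:
  fixes \<Omega> :: "(real ^ 'n) set"
  assumes op: "open \<Omega>" and smooth: "smooth_boundary \<Omega>" and p: "p \<in> frontier \<Omega>"
  obtains r P L t t1 t2 where "boundary_layer \<Omega> p r P L t t1 t2"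
    "\<And>x. 1 \<le> (\<Sum>i\<in>UNIV. (t1 i x)\<^sup>2)"
proof -
  obtain r k \<sigma> \<phi> where r: "0 < r" and \<sigma>: "\<sigma> \<in> {-1, 1::real}"
    and Ck: "\<forall>m. Ck_on m \<phi> UNIV"
    and indep: "\<forall>x y. (\<forall>i. i \<noteq> k \<longrightarrow> x $ i = y $ i) \<longrightarrow> \<phi> x = \<phi> y"
    and graph: "\<Omega> \<inter> ball p r = {x \<in> ball p r. \<phi> x < \<sigma> * x $ k}"
    using bspec[OF smooth[unfolded smooth_boundary_def] p] by (elim exE conjE bexE)
  note Ck = Ck[rule_format]
  \<comment> \<open>The trivial summands keep the terms in the shape of the rules for partial derivatives.\<close>
  define t where "t x = \<sigma> * (x $ k - 0) - \<phi> x" for x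
  define t1 where "t1 i x = \<sigma> * (if i = k then 1 else 0) - partial i \<phi> x" for i x
  define t2 where "t2 i x = 0 - partial i (partial i \<phi>) x" for i x
  have C1: "continuous_on S (partial i \<phi>)" for i S
    using Ck[of 1] by (auto intro: continuous_on_subset)
  have C2: "continuous_on S (partial i (partial i \<phi>))" for i S
  proof (rule continuous_on_subset)
    show "continuous_on UNIV (partial i (partial i \<phi>))" using Ck[of 2] by (simp add: numeral_2_eq_2)
  qed simp
  have "continuous_on (cball p (r/2)) (\<lambda>x. \<Sum>i\<in>UNIV. (t1 i x)\<^sup>2)"
    unfolding t1_def by (intro continuous_intros C1)
  then obtain P where P: "\<And>x. x \<in> cball p (r/2) \<Longrightarrow> \<bar>\<Sum>i\<in>UNIV. (t1 i x)\<^sup>2\<bar> \<le> P"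
    using continuous_on_compact_abs_le[OF compact_cball] by blast
  have "continuous_on (cball p (r/2)) (\<lambda>x. \<Sum>i\<in>UNIV. t2 i x)"
    unfolding t2_def by (intro continuous_intros C2)
  then obtain L where L: "\<And>x. x \<in> cball p (r/2) \<Longrightarrow> \<bar>\<Sum>i\<in>UNIV. t2 i x\<bar> \<le> L"
    using continuous_on_compact_abs_le[OF compact_cball] by blast
  have \<phi>_cont: "continuous_on S \<phi>" for S
    using Ck[of 0] by (auto intro: continuous_on_subset)
  have t_cont: "continuous_on S t" for S
    unfolding t_def by (intro continuous_intros \<phi>_cont)
  have "partial k \<phi> x = 0" for x
  proof -
    have "has_partial k \<phi> (partial k \<phi> x) x"
      by (rule Ck_on_2_has_partial(1)[OF Ck]) simp
    moreover have "\<phi> (x + s *\<^sub>R axis k 1) = \<phi> x" for s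
      by (rule indep[rule_format]) (simp add: axis_def)
    ultimately have "((\<lambda>s::real. \<phi> x) has_real_derivative partial k \<phi> x) (at 0)"
      by (simp add: has_partial_def)
    then show ?thesis by (rule DERIV_unique) simp
  qed
  then have "(t1 k x)\<^sup>2 = 1" for x using \<sigma> by (auto simp: t1_def)
  then have grad: "1 \<le> (\<Sum>i\<in>UNIV. (t1 i x)\<^sup>2)" for x
    using member_le_sum[of k UNIV "\<lambda>i. (t1 i x)\<^sup>2"] by simp
  have pos: "x \<in> \<Omega> \<longleftrightarrow> 0 < t x" if "x \<in> ball p r" for x
    using eqset_imp_iff[OF graph, of x] that by (simp add: t_def)
  have "boundary_layer \<Omega> p (r/2) P L t t1 t2"
  proof
    fix x assume x: "x \<in> frontier \<Omega>" "x \<in> ball p (r/2)"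
    then have xr: "x \<in> ball p r" using r by auto
    have "x \<notin> \<Omega>" using x op by (simp add: frontier_def interior_open)
    then have "t x \<le> 0" using pos[OF xr] by simp
    moreover have "0 \<le> t x"
    proof (rule ccontr)
      assume "\<not> 0 \<le> t x"
      then have "x \<in> ball p r \<inter> t -` {..<0}" using xr by simp
      moreover have "open (ball p r \<inter> t -` {..<0})"
        by (intro continuous_open_preimage t_cont) auto
      ultimately have "\<Omega> \<inter> (ball p r \<inter> t -` {..<0}) \<noteq> {}"
        using x(1) open_Int_closure_eq_empty[of "ball p r \<inter> t -` {..<0}" \<Omega>]
        by (auto simp: frontier_def)
      then obtain y where "y \<in> \<Omega>" "y \<in> ball p r" "t y < 0" by blast
      then show False using pos[of y] by simp
    qed
    ultimately show "t x = 0" by simp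
  next
    show "has_partial i t (t1 i x) x" for i x
      unfolding t_def t1_def
      by (intro has_partial_diff has_partial_cmult has_partial_nth Ck_on_2_has_partial[OF Ck]) simp
    show "has_partial i (t1 i) (t2 i x) x" for i x
      unfolding t1_def t2_def
      by (intro has_partial_diff has_partial_const Ck_on_2_has_partial[OF Ck]) simp
    show "(\<Sum>i\<in>UNIV. (t1 i x)\<^sup>2) \<le> P" if "x \<in> ball p (r/2)" for x using P[of x] that by simp
    show "\<bar>\<Sum>i\<in>UNIV. t2 i x\<bar> \<le> L" if "x \<in> ball p (r/2)" for x using L[of x] that by simp
  qed (use op p r t_cont pos in auto)
  then show ?thesis using grad by (rule that)
qed

section \<open>The nonexistence theorem\<close>

theorem theorem1p2:
  fixes \<Omega> :: "(real ^ 'n) set"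
    and a \<gamma> :: real
    and K :: "real ^ 'n \<Rightarrow> real"
    and f :: "real ^ 'n \<Rightarrow> real \<Rightarrow> real"
    and g :: "real \<Rightarrow> real"
  assumes N: "CARD('n) \<ge> 2"
    and dom: "smooth_bounded_domain \<Omega>"
    and a: "0 < a" "a \<le> 2"
    and gamma: "0 < \<gamma>" "\<gamma> < 1"
    and K_holder: "holder_on \<gamma> (closure \<Omega>) K"
    and f_nonneg: "\<And>x s. x \<in> closure \<Omega> \<Longrightarrow> 0 \<le> s \<Longrightarrow> 0 \<le> f x s"
    and f_holder: "\<exists>\<alpha>. 0 < \<alpha> \<and> \<alpha> \<le> 1 \<and> holder_on \<alpha> (closure \<Omega> \<times> {0..}) (\<lambda>(x, s). f x s)"
    and f_pos: "\<And>x s. x \<in> closure \<Omega> \<Longrightarrow> 0 < s \<Longrightarrow> 0 < f x s"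
    and f_mono: "\<And>x. x \<in> closure \<Omega> \<Longrightarrow> mono_on {0..} (f x)"
    and f_quot: "\<And>x. x \<in> closure \<Omega> \<Longrightarrow> antimono_on {0<..} (\<lambda>s. f x s / s)"
    and f_zero: "\<And>M. \<forall>\<^sub>F s in at_right 0. \<forall>x\<in>closure \<Omega>. M < f x s / s"
    and f_infty: "uniform_limit (closure \<Omega>) (\<lambda>s x. f x s / s) (\<lambda>x. 0) at_top"
    and g_holder: "\<And>p q. 0 < p \<Longrightarrow> p \<le> q \<Longrightarrow> holder_on \<gamma> {p..q} g"
    and g_nonneg: "\<And>s. 0 < s \<Longrightarrow> 0 \<le> g s"
    and g_antimono: "antimono_on {0<..} g"
    and g_zero: "filterlim g at_top (at_right 0)"
    and K_pos: "\<And>x. x \<in> closure \<Omega> \<Longrightarrow> 0 < K x"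
    and g_integral: "(\<integral>\<^sup>+ s \<in> {0<..<1}. ennreal (g s) \<partial>lborel) = \<infinity>"
  shows "\<forall>lam>0. \<not> (\<exists>u. classical_solution \<Omega> K f g a lam u)"
proof (intro allI impI notI)
  fix lam :: real assume lam: "0 < lam"
  assume "\<exists>u. classical_solution \<Omega> K f g a lam u"
  then obtain u where C2: "Ck_on 2 u \<Omega>" and cont: "continuous_on (closure \<Omega>) u"
    and eq: "\<And>x. x \<in> \<Omega> \<Longrightarrow> - laplacian u x + K x * g (u x) + norm (grad u x) powr a = lam * f x (u x)"
    and pos: "\<And>x. x \<in> \<Omega> \<Longrightarrow> 0 < u x" and zero: "\<And>x. x \<in> frontier \<Omega> \<Longrightarrow> u x = 0"
    unfolding classical_solution_def by blast
  have \<Omega>: "open \<Omega>" "\<Omega> \<noteq> {}" "bounded \<Omega>" "smooth_boundary \<Omega>"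
    using dom by (auto simp: smooth_bounded_domain_def)
  then have cpt: "compact (closure \<Omega>)" by simp
  have sub: "x \<in> closure \<Omega>" if "x \<in> \<Omega>" for x using that closure_subset by blast
  have "closure \<Omega> \<noteq> {}" using \<Omega> by auto
  then obtain z where z: "z \<in> closure \<Omega>" "\<And>x. x \<in> closure \<Omega> \<Longrightarrow> K z \<le> K x"
    using continuous_attains_inf[OF cpt _ holder_on_imp_continuous_on[OF K_holder gamma(1)]] by blast
  have k: "0 < K z" using K_pos z by blast
  obtain S where S: "0 \<le> S" "\<And>x. x \<in> closure \<Omega> \<Longrightarrow> \<bar>u x\<bar> \<le> S"
    using continuous_on_compact_abs_le[OF cpt cont] by blast
  have u_le: "u x \<le> S" if "x \<in> \<Omega>" for x using S(2)[OF sub[OF that]] by simp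
  have "continuous_on (closure \<Omega> \<times> {0..}) (\<lambda>(x, s). f x s)"
    using f_holder holder_on_imp_continuous_on by blast
  moreover have "0 \<le> u x" if "x \<in> closure \<Omega>" for x
    using that pos[of x] zero[of x] \<Omega>(1) by (force simp: frontier_def interior_open)
  moreover have "continuous_on (closure \<Omega>) (\<lambda>x. (x, u x))"
    by (intro continuous_intros cont)
  ultimately have "continuous_on (closure \<Omega>) (\<lambda>x. f x (u x))"
    using continuous_on_compose2[of "closure \<Omega> \<times> {0..}" "\<lambda>(x, s). f x s" "closure \<Omega>" "\<lambda>x. (x, u x)"]
    by force
  then obtain F where F: "0 \<le> F" "\<And>x. x \<in> closure \<Omega> \<Longrightarrow> \<bar>f x (u x)\<bar> \<le> F"
    using continuous_on_compact_abs_le[OF cpt] by blast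
  define C where "C = lam * F"
  have C: "0 \<le> C" using lam F by (simp add: C_def)
  have lap: "K z * g (u x) - C \<le> laplacian u x" if "x \<in> \<Omega>" for x
  proof -
    have "lam * f x (u x) \<le> C"
      unfolding C_def using F(2)[OF sub[OF that]] lam by (intro mult_left_mono) auto
    moreover have "K z * g (u x) \<le> K x * g (u x)"
      using z(2)[OF sub[OF that]] g_nonneg[OF pos[OF that]] by (rule mult_right_mono)
    moreover have "0 \<le> norm (grad u x) powr a" by simp
    ultimately show ?thesis using eq[OF that] by linarith
  qed
  have lap': "- C \<le> laplacian u x" if "x \<in> \<Omega>" for x
    using lap[OF that] mult_nonneg_nonneg[OF less_imp_le[OF k] g_nonneg[OF pos[OF that]]] by linarith
  have g_cont: "continuous_on {0<..} g"
  proof (rule continuous_at_imp_continuous_on, rule ballI)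
    fix s :: real assume s: "s \<in> {0<..}"
    then have "continuous_on {s / 2 .. s + 1} g"
      by (intro holder_on_imp_continuous_on[OF g_holder gamma(1)]) auto
    then show "isCont g s" by (rule continuous_on_interior) (use s in simp)
  qed
  have "frontier \<Omega> \<noteq> {}" using \<Omega> frontier_eq_empty not_bounded_UNIV by blast
  then obtain p where p: "p \<in> frontier \<Omega>" by blast
  obtain r P L t t1 t2 where layer: "boundary_layer \<Omega> p r P L t t1 t2"
    and grad: "\<And>x. 1 \<le> (\<Sum>i\<in>UNIV. (t1 i x)\<^sup>2)"
    using exists_boundary_layer[OF \<Omega>(1,4) p] by blast
  interpret t: boundary_layer \<Omega> p r P L t t1 t2 by (rule layer)
  obtain A where A: "0 < A" "\<And>x. x \<in> \<Omega> \<inter> ball p (r/2) \<Longrightarrow> u x \<le> A * t x"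
    using t.linear_upper_bound[OF C2 cont zero grad S(1) u_le C lap'] by blast
  interpret s: boundary_layer \<Omega> p "r/2" "A\<^sup>2 * P" "A * L" "\<lambda>x. A * t x" "\<lambda>i x. A * t1 i x" "\<lambda>i x. A * t2 i x"
    using A t.radius by (intro t.scaled) auto
  show False
  proof (rule s.no_subsolution_below_t[OF C2 cont zero pos _ S(1) u_le k lap g_cont g_nonneg g_antimono g_zero])
    show "u x \<le> A * t x" if "x \<in> \<Omega>" "x \<in> ball p (r/2)" for x using A that by blast
    show "\<exists>\<epsilon>>0. \<epsilon> < \<sigma> \<and> B \<le> integral {\<epsilon>..\<sigma>} g" if "0 < \<sigma>" for \<sigma> B
      using unbounded_integral_at_0[OF g_cont g_nonneg g_integral that] by blast
  qed
qed

end
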